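(* Let $\mathbb{K}$ be a field and let $\Delta$ be a $\mathbb{K}$-spherical complex on $n$ vertices with $\tilde H_{d}(\Delta;\mathbb{K})\cong\mathbb{K}$. (1) If $\Sigma$ is an induced subcomplex of $\Delta$ on $m$ vertices such that $\tilde H_{d'}(\Sigma;\mathbb{K})\cong\mathbb{K}$, then $d-(n-m)\le d'\le d$. (2) If $\sigma\in\Delta$ is a face with $k$ vertices such that $\tilde H_{d''}(\mathrm{link}_\Delta(\sigma);\mathbb{K})\cong\mathbb{K}$, then $d-k\le d''\le d$. In particular, the Leray number of $\Delta$ satisfies $L_{\mathbb{K}}(\Delta)=d+1$.
   Context: All simplicial complexes are finite; $\{\emptyset\}$ denotes the complex whose only face is the empty set, so $\tilde H_{-1}(\{\emptyset\};\mathbb{K})\cong\mathbb{K}$, and the void complex $\{\}$ with no faces has zero homology. A vertex of $\Delta$ is an element $v$ with $\{v\}\in\Delta$. For a vertex $v$ of $\Delta$, $\mathrm{del}_\Delta(v)=\{\sigma\in\Delta: v\notin\sigma\}$ and $\mathrm{link}_\Delta(v)=\{\sigma\in\mathrm{del}_\Delta(v):\sigma\cup\{v\}\in\Delta\}$. For a face $\sigma\in\Delta$, $\mathrm{link}_\Delta(\sigma)=\{\tau\in\Delta:\tau\cap\sigma=\emptyset,\ \tau\cup\sigma\in\Delta\}$. The induced subcomplex of $\Delta$ on a set $A$ of vertices is $\{\tau\in\Delta:\tau\subseteq A\}$. A simplicial complex $\Delta$ is $\mathbb{K}$-spherical if (recursively) (i) $\tilde H_i(\Delta;\mathbb{K})$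 is one-dimensional for at most one $i$ and is zero for all other $i$; and (ii) for every vertex $v$ of $\Delta$ both $\mathrm{link}_\Delta(v)$ and $\mathrm{del}_\Delta(v)$ are $\mathbb{K}$-spherical. The Leray number $L_{\mathbb{K}}(\Delta)$ is the minimum $d$ such that $\tilde H_i(\Gamma;\mathbb{K})=0$ for all $i\ge d$ and all induced subcomplexes $\Gamma$ of $\Delta$. *)

theory Defs
  imports Complex_Main "HOL-Library.Function_Algebras" "HOL-Library.Set_Algebras"
begin

section \<open>Finite simplicial complexes\<close>

text \<open>
  A complex is its set of faces, the empty face included.  The void complex \<open>{}\<close> is allowed
  and differs from \<open>{{}}\<close>.  Elements of the vertex type need not be vertices of the complex.
\<close>

definition simplicial_complex :: "'a set set \<Rightarrow> bool" where
  "simplicial_complex \<Delta> \<longleftrightarrow>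
     finite \<Delta> \<and> (\<forall>\<sigma>\<in>\<Delta>. finite \<sigma>) \<and> (\<forall>\<sigma>\<in>\<Delta>. \<forall>\<tau>. \<tau> \<subseteq> \<sigma> \<longrightarrow> \<tau> \<in> \<Delta>)"

definition vertices :: "'a set set \<Rightarrow> 'a set" where
  "vertices \<Delta> = {v. {v} \<in> \<Delta>}"

definition deletion :: "'a set set \<Rightarrow> 'a \<Rightarrow> 'a set set" where
  "deletion \<Delta> v = {\<sigma> \<in> \<Delta>. v \<notin> \<sigma>}"

definition vertex_link :: "'a set set \<Rightarrow> 'a \<Rightarrow> 'a set set" where
  "vertex_link \<Delta> v = {\<sigma> \<in> deletion \<Delta> v. \<sigma> \<union> {v} \<in> \<Delta>}"

definition face_link :: "'a set set \<Rightarrow> 'a set \<Rightarrow> 'a set set" where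
  "face_link \<Delta> \<sigma> = {\<tau> \<in> \<Delta>. \<tau> \<inter> \<sigma> = {} \<and> \<tau> \<union> \<sigma> \<in> \<Delta>}"

definition induced_subcomplex :: "'a set set \<Rightarrow> 'a set \<Rightarrow> 'a set set" where
  "induced_subcomplex \<Delta> A = {\<tau> \<in> \<Delta>. \<tau> \<subseteq> A}"


section \<open>Reduced simplicial homology with coefficients in a field\<close>

text \<open>
  An \<open>i\<close>-chain is the function of its coefficients, supported on the faces with \<open>i + 1\<close> vertices,
  each oriented by the linear order of the vertex type.  Degrees are integers; the empty face
  lives in degree \<open>-1\<close>.
\<close>

definition chains :: "'a set set \<Rightarrow> int \<Rightarrow> ('a set \<Rightarrow> 'k::field) set" where
  "chains \<Delta> i = {c. \<forall>\<sigma>. c \<sigma> \<noteq> 0 \<longrightarrow> \<sigma> \<in> \<Delta> \<and> int (card \<sigma>) = i + 1}"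

text \<open>
  The boundary sends a face \<open>\<sigma> = {v\<^sub>0 < \<dots> < v\<^sub>i}\<close> to
  \<open>\<Sum>\<^sub>j (-1)\<^sup>j (\<sigma> - {v\<^sub>j})\<close>.  Thus the coefficient of the boundary of \<open>c\<close> at \<open>\<tau>\<close> collects the faces
  \<open>insert v \<tau>\<close>, in which \<open>v\<close> has position \<open>card {u \<in> \<tau>. u < v}\<close>.  On 0-chains this is the augmentation.
\<close>

definition boundary :: "'a::linorder set set \<Rightarrow> ('a set \<Rightarrow> 'k::field) \<Rightarrow> 'a set \<Rightarrow> 'k" where
  "boundary \<Delta> c = (\<lambda>\<tau>. \<Sum>v \<in> vertices \<Delta> - \<tau>. (-1) ^ card {u \<in> \<tau>. u < v} * c (insert v \<tau>))"

definition cycles :: "'a::linorder set set \<Rightarrow> int \<Rightarrow> ('a set \<Rightarrow> 'k::field) set" where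
  "cycles \<Delta> i = {c \<in> chains \<Delta> i. boundary \<Delta> c = 0}"

definition boundaries :: "'a::linorder set set \<Rightarrow> int \<Rightarrow> ('a set \<Rightarrow> 'k::field) set" where
  "boundaries \<Delta> i = boundary \<Delta> ` chains \<Delta> (i + 1)"

definition homology_class ::
    "'a::linorder set set \<Rightarrow> int \<Rightarrow> ('a set \<Rightarrow> 'k::field) \<Rightarrow> ('a set \<Rightarrow> 'k) set" where
  "homology_class \<Delta> i z = z +o boundaries \<Delta> i"

definition reduced_homology ::
    "'a::linorder set set \<Rightarrow> int \<Rightarrow> ('a set \<Rightarrow> 'k::field) set set" where
  "reduced_homology \<Delta> i = homology_class \<Delta> i ` cycles \<Delta> i"

definition homology_zero :: "'k::field itself \<Rightarrow> 'a::linorder set set \<Rightarrow> int \<Rightarrow> bool" where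
  "homology_zero K \<Delta> i \<longleftrightarrow>
     (reduced_homology \<Delta> i :: ('a set \<Rightarrow> 'k) set set) = {homology_class \<Delta> i 0}"

text \<open>
  The homology is isomorphic to the ground field, equivalently one-dimensional.  The vector space
  operations on the quotient are the ones induced from cycles.
\<close>

definition homology_iso_field :: "'k::field itself \<Rightarrow> 'a::linorder set set \<Rightarrow> int \<Rightarrow> bool" where
  "homology_iso_field K \<Delta> i \<longleftrightarrow>
     (\<exists>f :: ('a set \<Rightarrow> 'k) set \<Rightarrow> 'k.
        bij_betw f (reduced_homology \<Delta> i) UNIV \<and>
        (\<forall>x \<in> cycles \<Delta> i. \<forall>y \<in> cycles \<Delta> i.
           f (homology_class \<Delta> i (x + y)) = f (homology_class \<Delta> i x) + f (homology_class \<Delta> i y)) \<and>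
        (\<forall>a. \<forall>x \<in> cycles \<Delta> i.
           f (homology_class \<Delta> i (\<lambda>\<sigma>. a * x \<sigma>)) = a * f (homology_class \<Delta> i x)))"


section \<open>Spherical complexes and the Leray number\<close>

text \<open>
  The recursion is well-founded since \<open>v\<close> is a vertex of neither its link nor its deletion, so the
  least fixed point is the intended predicate.
\<close>

inductive spherical :: "'k::field itself \<Rightarrow> 'a::linorder set set \<Rightarrow> bool"
  for K :: "'k::field itself" where
  sphericalI:
    "\<lbrakk> simplicial_complex \<Delta>;
       \<exists>\<^sub>\<le>\<^sub>1 i. homology_iso_field K \<Delta> i;
       \<forall>i. \<not> homology_iso_field K \<Delta> i \<longrightarrow> homology_zero K \<Delta> i;
       \<And>v. v \<in> vertices \<Delta> \<Longrightarrow> spherical K (vertex_link \<Delta> v);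
       \<And>v. v \<in> vertices \<Delta> \<Longrightarrow> spherical K (deletion \<Delta> v) \<rbrakk>
     \<Longrightarrow> spherical K \<Delta>"

text \<open>
  A natural number: any non-void complex has \<open>{{}}\<close> as an induced subcomplex, whose homology in
  degree \<open>-1\<close> is non-zero.  (The void complex, where every degree works, gets the value 0.)
\<close>

definition leray_number :: "'k::field itself \<Rightarrow> 'a::linorder set set \<Rightarrow> nat" where
  "leray_number K \<Delta> =
     (LEAST d. \<forall>A \<subseteq> vertices \<Delta>. \<forall>i \<ge> int d. homology_zero K (induced_subcomplex \<Delta> A) i)"

end

theory Submission
  imports Defs
begin

text \<open>
  For a vertex \<open>v\<close> of \<open>\<Delta>\<close> with link \<open>L\<close> and deletion \<open>D\<close>, the complex is \<open>D\<close> with a cone over \<open>L\<close>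
  attached, which gives the long exact sequence
  \<open>\<dots> \<rightarrow> H\<^sub>i(L) \<rightarrow> H\<^sub>i(D) \<rightarrow> H\<^sub>i(\<Delta>) \<rightarrow> H\<^sub>i\<^sub>-\<^sub>1(L) \<rightarrow> H\<^sub>i\<^sub>-\<^sub>1(D) \<rightarrow> \<dots>\<close>.
  Hence a nonzero term forces one of its two neighbours to be nonzero (\<open>homology_zero_complex\<close>,
  \<open>homology_zero_deletion\<close>, \<open>homology_zero_link\<close>).

  A complex with homology can become acyclic after one deletion and regain homology after further
  ones, so degrees cannot be tracked along a chain of deletions.
  In \<open>induced_subcomplex_degree_bounds\<close> this is resolved by passing to a link.  Let \<open>\<Sigma>\<close> be the
  induced subcomplex on \<open>A\<close>, with nonzero homology in degree \<open>e\<close>, let \<open>\<Delta>\<close> have nonzero homology in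
  degree \<open>d\<close>, and let \<open>v\<close> be a vertex outside \<open>A\<close>.  If \<open>H\<^sub>d(D)\<close> is nonzero, the question is reduced
  to \<open>D\<close>, of which \<open>\<Sigma>\<close> is an induced subcomplex.  If the induced subcomplex on \<open>insert v A\<close> has
  nonzero homology in degree \<open>e\<close>, it takes the place of \<open>\<Sigma>\<close>, and one vertex fewer is missing.
  Otherwise exactness, applied once in \<open>\<Delta>\<close> and once in the complex on \<open>insert v A\<close>, gives nonzero
  homology in degree \<open>d - 1\<close> for \<open>L\<close> and in degree \<open>e\<close> for its induced subcomplex on \<open>A\<close>, so the
  question is reduced to \<open>L\<close>.  When no vertex is missing, \<open>d = e\<close> because the homology of a spherical
  complex is concentrated in one degree.  The bound for links of faces, \<open>face_link_degree_bounds\<close>,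
  has the same proof with the roles of link and deletion exchanged.

  The upper bound on the degrees of induced subcomplexes, attained by \<open>\<Delta>\<close> itself, is the
  statement about the Leray number.
\<close>

section \<open>Cycles and boundaries as subspaces\<close>

lemma boundary_add: "boundary \<Gamma> (x + y) = boundary \<Gamma> x + boundary \<Gamma> y"
  by (rule ext) (simp add: boundary_def distrib_left sum.distrib)

lemma boundary_uminus: "boundary \<Gamma> (- x) = - boundary \<Gamma> x"
  by (rule ext) (simp add: boundary_def sum_negf)

lemma boundary_zero: "boundary \<Gamma> 0 = 0"
  by (rule ext) (simp add: boundary_def)

lemma chains_add: "\<lbrakk>x \<in> chains \<Gamma> i; y \<in> chains \<Gamma> i\<rbrakk> \<Longrightarrow> x + y \<in> chains \<Gamma> i"
  unfolding chains_def by (auto simp: plus_fun_def) (metis add.right_neutral)+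

lemma chains_uminus: "x \<in> chains \<Gamma> i \<Longrightarrow> - x \<in> chains \<Gamma> i"
  unfolding chains_def by auto

lemma chains_zero: "0 \<in> chains \<Gamma> i"
  unfolding chains_def by auto

lemma chains_mono: "\<Gamma> \<subseteq> \<Gamma>' \<Longrightarrow> chains \<Gamma> i \<subseteq> chains \<Gamma>' i"
  unfolding chains_def by auto

lemma cycles_zero: "0 \<in> cycles \<Gamma> i"
  unfolding cycles_def by (simp add: chains_zero boundary_zero)

lemma boundaries_add: "\<lbrakk>x \<in> boundaries \<Gamma> i; y \<in> boundaries \<Gamma> i\<rbrakk> \<Longrightarrow> x + y \<in> boundaries \<Gamma> i"
  unfolding boundaries_def by (auto simp flip: boundary_add intro: chains_add)

lemma boundaries_uminus: "x \<in> boundaries \<Gamma> i \<Longrightarrow> - x \<in> boundaries \<Gamma> i"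
  unfolding boundaries_def by (auto simp flip: boundary_uminus intro: chains_uminus)

lemma boundaries_zero: "0 \<in> boundaries \<Gamma> i"
  unfolding boundaries_def using chains_zero boundary_zero by (metis image_eqI)

lemma boundaries_of_diff:
  assumes "x - y \<in> boundaries \<Gamma> i" and "y \<in> boundaries \<Gamma> i"
  shows "x \<in> boundaries \<Gamma> i"
  using boundaries_add[OF assms] by simp

lemma homology_class_eq_iff:
  "homology_class \<Gamma> i x = homology_class \<Gamma> i y \<longleftrightarrow> x - y \<in> boundaries \<Gamma> i"
proof
  assume "homology_class \<Gamma> i x = homology_class \<Gamma> i y"
  moreover have "x \<in> homology_class \<Gamma> i x"
    unfolding homology_class_def elt_set_plus_def using boundaries_zero by force
  ultimately show "x - y \<in> boundaries \<Gamma> i"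
    unfolding homology_class_def elt_set_plus_def by auto
next
  have sub: "homology_class \<Gamma> i u \<subseteq> homology_class \<Gamma> i w" if "u - w \<in> boundaries \<Gamma> i" for u w
  proof
    fix z assume "z \<in> homology_class \<Gamma> i u"
    then obtain b where b: "b \<in> boundaries \<Gamma> i" "z = u + b"
      unfolding homology_class_def elt_set_plus_def by auto
    have "z = w + ((u - w) + b)" using b by simp
    then show "z \<in> homology_class \<Gamma> i w"
      unfolding homology_class_def elt_set_plus_def using boundaries_add[OF that b(1)] by blast
  qed
  assume "x - y \<in> boundaries \<Gamma> i"
  moreover from boundaries_uminus[OF this] have "y - x \<in> boundaries \<Gamma> i" by simp
  ultimately show "homology_class \<Gamma> i x = homology_class \<Gamma> i y" using sub by blast
qed

text \<open>
  Classes are cosets, so a single class means that every cycle lies in the subspace of boundaries.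
\<close>

lemma homology_zero_iff:
  "homology_zero TYPE('k::field) \<Gamma> i \<longleftrightarrow> (cycles \<Gamma> i :: ('a::linorder set \<Rightarrow> 'k) set) \<subseteq> boundaries \<Gamma> i"
proof -
  have "homology_zero TYPE('k) \<Gamma> i \<longleftrightarrow>
      (\<forall>z \<in> cycles \<Gamma> i :: ('a set \<Rightarrow> 'k) set. homology_class \<Gamma> i z = homology_class \<Gamma> i 0)"
    unfolding homology_zero_def reduced_homology_def using cycles_zero[of \<Gamma> i] by auto
  then show ?thesis by (auto simp: homology_class_eq_iff)
qed

lemma homology_iso_field_not_zero:
  assumes "homology_iso_field TYPE('k::field) \<Gamma> i"
  shows "\<not> homology_zero TYPE('k) \<Gamma> i"
proof
  assume z: "homology_zero TYPE('k) \<Gamma> i"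
  obtain f where "bij_betw f (reduced_homology \<Gamma> i :: ('a set \<Rightarrow> 'k) set set) (UNIV :: 'k set)"
    using assms unfolding homology_iso_field_def by blast
  then have "(UNIV :: 'k set) = {f (homology_class \<Gamma> i 0)}"
    using z unfolding homology_zero_def bij_betw_def by auto
  then have "(0::'k) = 1" by (metis UNIV_I singletonD)
  then show False by simp
qed

text \<open>No face has a negative number of vertices, so there are no nonzero chains below degree \<open>-1\<close>.\<close>

lemma homology_zero_below:
  assumes "i < -1"
  shows "homology_zero TYPE('k::field) \<Gamma> i"
proof -
  have "(cycles \<Gamma> i :: ('a set \<Rightarrow> 'k) set) \<subseteq> {0}"
    using assms unfolding cycles_def chains_def by (fastforce simp: fun_eq_iff)
  then show ?thesis unfolding homology_zero_iff using boundaries_zero by blast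
qed

section \<open>Link and deletion of a vertex\<close>

lemma simplicial_complex_subface:
  "\<lbrakk>simplicial_complex \<Delta>; \<sigma> \<in> \<Delta>; \<tau> \<subseteq> \<sigma>\<rbrakk> \<Longrightarrow> \<tau> \<in> \<Delta>"
  unfolding simplicial_complex_def by metis

lemma simplicial_complex_deletion: "simplicial_complex \<Delta> \<Longrightarrow> simplicial_complex (deletion \<Delta> v)"
  unfolding simplicial_complex_def deletion_def by auto

lemma simplicial_complex_vertex_link:
  "simplicial_complex \<Delta> \<Longrightarrow> simplicial_complex (vertex_link \<Delta> v)"
  unfolding simplicial_complex_def
proof (intro conjI ballI allI impI; elim conjE)
  assume fin: "finite \<Delta>" and "\<forall>\<sigma>\<in>\<Delta>. finite \<sigma>" and down: "\<forall>\<sigma>\<in>\<Delta>. \<forall>\<tau>. \<tau> \<subseteq> \<sigma> \<longrightarrow> \<tau> \<in> \<Delta>"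
  have sub: "vertex_link \<Delta> v \<subseteq> \<Delta>" unfolding vertex_link_def deletion_def by auto
  show "finite (vertex_link \<Delta> v)" by (rule finite_subset[OF sub fin])
  show "finite \<sigma>" if "\<sigma> \<in> vertex_link \<Delta> v" for \<sigma>
    using that sub \<open>\<forall>\<sigma>\<in>\<Delta>. finite \<sigma>\<close> by blast
  show "\<tau> \<in> vertex_link \<Delta> v" if "\<sigma> \<in> vertex_link \<Delta> v" "\<tau> \<subseteq> \<sigma>" for \<sigma> \<tau>
  proof -
    have "\<sigma> \<in> \<Delta>" "v \<notin> \<sigma>" "\<sigma> \<union> {v} \<in> \<Delta>" "\<tau> \<union> {v} \<subseteq> \<sigma> \<union> {v}"
      using that unfolding vertex_link_def deletion_def by auto
    then have "\<tau> \<in> \<Delta>" "v \<notin> \<tau>" "\<tau> \<union> {v} \<in> \<Delta>" using down that(2) by blast+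
    then show ?thesis unfolding vertex_link_def deletion_def by simp
  qed
qed

lemma finite_vertices: "simplicial_complex \<Delta> \<Longrightarrow> finite (vertices \<Delta>)"
proof -
  assume "simplicial_complex \<Delta>"
  then have "finite ((\<lambda>v. {v}) ` vertices \<Delta>)"
    unfolding simplicial_complex_def vertices_def by (auto intro: finite_subset)
  then show ?thesis by (rule finite_imageD) simp
qed

lemma vertices_deletion: "vertices (deletion \<Delta> v) = vertices \<Delta> - {v}"
  unfolding vertices_def deletion_def by auto

lemma vertices_vertex_link: "vertices (vertex_link \<Delta> v) \<subseteq> vertices \<Delta> - {v}"
  unfolding vertices_def vertex_link_def deletion_def by auto

definition incidence_sign :: "'a::linorder \<Rightarrow> 'a set \<Rightarrow> 'k::field" where
  "incidence_sign v \<tau> = (-1) ^ card {u \<in> \<tau>. u < v}"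

lemma incidence_sign_square: "incidence_sign v \<tau> * (incidence_sign v \<tau> * x) = x"
proof -
  have "incidence_sign v \<tau> * incidence_sign v \<tau> = (1::'a)"
    unfolding incidence_sign_def by (simp flip: power_mult_distrib)
  then show ?thesis by (simp flip: mult.assoc)
qed

lemma incidence_sign_insert:
  assumes "finite \<tau>" "w \<notin> \<tau>"
  shows "incidence_sign v (insert w \<tau>) = (if w < v then - incidence_sign v \<tau> else incidence_sign v \<tau>)"
proof -
  have "{u \<in> insert w \<tau>. u < v} = (if w < v then insert w {u \<in> \<tau>. u < v} else {u \<in> \<tau>. u < v})"
    by auto
  then show ?thesis using assms unfolding incidence_sign_def by simp
qed

text \<open>
  Of two distinct vertices exactly one precedes the other, so adding one of them changes the position
  of the other in exactly one of the two orders.  This is where the minus sign in the boundary of a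
  cone comes from.
\<close>

lemma incidence_sign_swap:
  assumes "finite \<tau>" "v \<notin> \<tau>" "w \<notin> \<tau>" "v \<noteq> w"
  shows "incidence_sign v \<tau> * incidence_sign w (insert v \<tau>)
       = - (incidence_sign w \<tau> * incidence_sign v (insert w \<tau>) :: 'k::field)"
  using assms by (auto simp: incidence_sign_insert)

text \<open>
  A chain of \<open>\<Delta>\<close> splits into its coefficients on the faces through \<open>v\<close> and on the faces avoiding \<open>v\<close>.
  The former are regarded as a chain on the link; the sign corrects for the position of \<open>v\<close> in
  the face, as if \<open>v\<close> came first in the order.
\<close>

definition link_part :: "'a::linorder \<Rightarrow> ('a set \<Rightarrow> 'k::field) \<Rightarrow> 'a set \<Rightarrow> 'k" where
  "link_part v c = (\<lambda>\<tau>. if v \<in> \<tau> then 0 else incidence_sign v \<tau> * c (insert v \<tau>))"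

definition deletion_part :: "'a \<Rightarrow> ('a set \<Rightarrow> 'k::field) \<Rightarrow> 'a set \<Rightarrow> 'k" where
  "deletion_part v c = (\<lambda>\<tau>. if v \<in> \<tau> then 0 else c \<tau>)"

text \<open>The inverse of the splitting into \<open>link_part\<close> and \<open>deletion_part\<close>.\<close>

definition join_parts ::
    "'a::linorder \<Rightarrow> ('a set \<Rightarrow> 'k::field) \<Rightarrow> ('a set \<Rightarrow> 'k) \<Rightarrow> 'a set \<Rightarrow> 'k" where
  "join_parts v l e =
     (\<lambda>\<sigma>. if v \<in> \<sigma> then incidence_sign v (\<sigma> - {v}) * l (\<sigma> - {v}) else e \<sigma>)"

lemma link_part_diff: "link_part v (x - y) = link_part v x - link_part v y"
  by (rule ext) (simp add: link_part_def right_diff_distrib)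

lemma deletion_part_diff: "deletion_part v (x - y) = deletion_part v x - deletion_part v y"
  by (rule ext) (simp add: deletion_part_def)

lemma eq_if_parts_eq:
  assumes l: "link_part v x = link_part v y" and d: "deletion_part v x = deletion_part v y"
  shows "x = y"
proof
  fix \<sigma>
  show "x \<sigma> = y \<sigma>"
  proof (cases "v \<in> \<sigma>")
    case True
    then have "incidence_sign v (\<sigma> - {v}) * x \<sigma> = incidence_sign v (\<sigma> - {v}) * y \<sigma>"
      using fun_cong[OF l, of "\<sigma> - {v}"] by (simp add: link_part_def insert_absorb)
    then show ?thesis by (metis incidence_sign_square)
  next
    case False
    then show ?thesis using fun_cong[OF d, of \<sigma>] by (simp add: deletion_part_def)
  qed
qed

text \<open>
  The sum in \<open>boundary\<close> ranges over the vertices of the complex.  Enlarging that range does not change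
  the value on chains of the complex, which makes the boundaries in \<open>L\<close>, \<open>D\<close> and \<open>\<Delta>\<close> comparable.
\<close>

lemma boundary_sum_over_superset:
  assumes \<Gamma>: "simplicial_complex \<Gamma>" and c: "c \<in> chains \<Gamma> i"
    and W: "finite W" "vertices \<Gamma> \<subseteq> W"
  shows "boundary \<Gamma> c \<tau> = (\<Sum>w \<in> W - \<tau>. incidence_sign w \<tau> * c (insert w \<tau>))"
  unfolding boundary_def incidence_sign_def
proof (rule sum.mono_neutral_left)
  show "\<forall>w \<in> W - \<tau> - (vertices \<Gamma> - \<tau>). (-1) ^ card {u \<in> \<tau>. u < w} * c (insert w \<tau>) = 0"
  proof
    fix w assume "w \<in> W - \<tau> - (vertices \<Gamma> - \<tau>)"
    then have "{w} \<notin> \<Gamma>" unfolding vertices_def by auto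
    then have "insert w \<tau> \<notin> \<Gamma>" using simplicial_complex_subface[OF \<Gamma>, of "insert w \<tau>" "{w}"] by auto
    then show "(-1) ^ card {u \<in> \<tau>. u < w} * c (insert w \<tau>) = 0"
      using c unfolding chains_def by auto
  qed
qed (use W in auto)

section \<open>The exact sequence of link, deletion and complex\<close>

locale complex_with_vertex =
  fixes \<Delta> :: "'a::linorder set set" and v :: 'a
  assumes complex: "simplicial_complex \<Delta>" and vertex: "v \<in> vertices \<Delta>"
begin

abbreviation "L \<equiv> vertex_link \<Delta> v"
abbreviation "D \<equiv> deletion \<Delta> v"

lemma finite_face: "\<sigma> \<in> \<Delta> \<Longrightarrow> finite \<sigma>"
  using complex unfolding simplicial_complex_def by auto

lemma link_chain_imp_deletion_chain: "c \<in> chains L i \<Longrightarrow> c \<in> chains D i"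
  using chains_mono[of L D] unfolding vertex_link_def by auto

lemma deletion_chain_imp_chain: "c \<in> chains D i \<Longrightarrow> c \<in> chains \<Delta> i"
  using chains_mono[of D \<Delta>] unfolding deletion_def by auto

lemma deletion_chain_parts:
  assumes "c \<in> chains D i"
  shows "link_part v c = 0" "deletion_part v c = c"
  using assms unfolding chains_def deletion_def link_part_def deletion_part_def
  by (fastforce simp: fun_eq_iff)+

lemma link_part_chain:
  assumes "c \<in> chains \<Delta> i"
  shows "link_part v c \<in> chains L (i - 1)"
proof -
  have "\<tau> \<in> L \<and> int (card \<tau>) = i - 1 + 1" if nz: "link_part v c \<tau> \<noteq> 0" for \<tau>
  proof -
    have v: "v \<notin> \<tau>" and "c (insert v \<tau>) \<noteq> 0"
      using nz unfolding link_part_def by (auto split: if_splits)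
    then have f: "insert v \<tau> \<in> \<Delta>" "int (card (insert v \<tau>)) = i + 1"
      using assms unfolding chains_def by auto
    then have "\<tau> \<in> \<Delta>" using simplicial_complex_subface[OF complex] by (metis subset_insertI)
    with v f show ?thesis
      using finite_face[of \<tau>] unfolding vertex_link_def deletion_def by auto
  qed
  then show ?thesis unfolding chains_def by auto
qed

lemma deletion_part_chain: "c \<in> chains \<Delta> i \<Longrightarrow> deletion_part v c \<in> chains D i"
  unfolding chains_def deletion_part_def deletion_def by (auto split: if_splits)

lemma join_parts_chain:
  assumes l: "l \<in> chains L (i - 1)" and e: "e \<in> chains D i"
  shows "join_parts v l e \<in> chains \<Delta> i"
proof -
  have "\<sigma> \<in> \<Delta> \<and> int (card \<sigma>) = i + 1" if nz: "join_parts v l e \<sigma> \<noteq> 0" for \<sigma>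
  proof (cases "v \<in> \<sigma>")
    case True
    then have "l (\<sigma> - {v}) \<noteq> 0" and ins: "insert v (\<sigma> - {v}) = \<sigma>"
      using nz unfolding join_parts_def by (auto split: if_splits)
    then have f: "\<sigma> - {v} \<in> L" "int (card (\<sigma> - {v})) = i"
      using l unfolding chains_def by auto
    then have "\<sigma> \<in> \<Delta>" using ins unfolding vertex_link_def by auto
    moreover have "card \<sigma> = Suc (card (\<sigma> - {v}))"
      using finite_face[OF calculation] True by (rule card.remove)
    ultimately show ?thesis using f by simp
  next
    case False
    then show ?thesis using nz e unfolding join_parts_def chains_def deletion_def by auto
  qed
  then show ?thesis unfolding chains_def by auto
qed

lemma parts_join_parts:
  assumes l: "l \<in> chains L j" and e: "e \<in> chains D i"
  shows "link_part v (join_parts v l e) = l" "deletion_part v (join_parts v l e) = e"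
proof -
  have "l \<tau> = 0 \<and> e \<tau> = 0" if "v \<in> \<tau>" for \<tau>
    using that l e unfolding chains_def vertex_link_def deletion_def by auto
  then show "link_part v (join_parts v l e) = l" "deletion_part v (join_parts v l e) = e"
    by (auto simp: fun_eq_iff link_part_def deletion_part_def join_parts_def incidence_sign_square)
qed

lemmas boundary_\<Delta> = boundary_sum_over_superset[OF complex _ finite_vertices[OF complex] order_refl]

lemma boundary_D:
  assumes "c \<in> chains D i"
  shows "boundary D c \<tau> = (\<Sum>w \<in> vertices \<Delta> - \<tau>. incidence_sign w \<tau> * c (insert w \<tau>))"
proof (rule boundary_sum_over_superset[OF simplicial_complex_deletion[OF complex] assms
      finite_vertices[OF complex]])
  show "vertices D \<subseteq> vertices \<Delta>" unfolding vertices_deletion by blast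
qed

lemma boundary_L:
  assumes "c \<in> chains L i"
  shows "boundary L c \<tau> = (\<Sum>w \<in> vertices \<Delta> - \<tau>. incidence_sign w \<tau> * c (insert w \<tau>))"
proof (rule boundary_sum_over_superset[OF simplicial_complex_vertex_link[OF complex] assms
      finite_vertices[OF complex]])
  show "vertices L \<subseteq> vertices \<Delta>" by (rule subset_trans[OF vertices_vertex_link Diff_subset])
qed

lemma boundary_link_eq_deletion:
  assumes "c \<in> chains L i"
  shows "boundary L c = boundary D c"
  by (rule ext)
    (simp only: boundary_L[OF assms] boundary_D[OF link_chain_imp_deletion_chain[OF assms]])

lemma boundary_deletion_eq:
  assumes "c \<in> chains D i"
  shows "boundary D c = boundary \<Delta> c"
  by (rule ext) (simp only: boundary_D[OF assms] boundary_\<Delta>[OF deletion_chain_imp_chain[OF assms]])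

text \<open>
  The next two lemmas say that the chain complex of \<open>\<Delta>\<close> is the mapping cone of the inclusion of \<open>L\<close>
  into \<open>D\<close>.  On a face avoiding \<open>v\<close> the summand of the boundary that adds \<open>v\<close> is split off; it is
  the coefficient of the link part.
\<close>

lemma deletion_part_boundary:
  assumes c: "c \<in> chains \<Delta> i"
  shows "deletion_part v (boundary \<Delta> c) = boundary D (deletion_part v c) + link_part v c"
proof
  fix \<tau>
  show "deletion_part v (boundary \<Delta> c) \<tau> = (boundary D (deletion_part v c) + link_part v c) \<tau>"
  proof (cases "v \<in> \<tau>")
    case True
    then show ?thesis
      by (simp add: boundary_D[OF deletion_part_chain[OF c]]) (simp add: deletion_part_def link_part_def)
  next
    case False
    have "boundary D (deletion_part v c) \<tau> =
        (\<Sum>w \<in> vertices \<Delta> - \<tau> - {v}. incidence_sign w \<tau> * c (insert w \<tau>))"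
      unfolding boundary_D[OF deletion_part_chain[OF c]]
      by (rule sum.mono_neutral_cong_right)
        (use False finite_vertices[OF complex] in \<open>auto simp: deletion_part_def\<close>)
    moreover have "boundary \<Delta> c \<tau> = incidence_sign v \<tau> * c (insert v \<tau>) +
        (\<Sum>w \<in> vertices \<Delta> - \<tau> - {v}. incidence_sign w \<tau> * c (insert w \<tau>))"
      unfolding boundary_\<Delta>[OF c]
      using False vertex finite_vertices[OF complex] by (subst sum.remove[of _ v]) auto
    ultimately show ?thesis using False by (simp add: deletion_part_def link_part_def)
  qed
qed

lemma link_part_boundary:
  assumes c: "c \<in> chains \<Delta> i"
  shows "link_part v (boundary \<Delta> c) = - boundary L (link_part v c)"
proof
  fix \<tau>
  show "link_part v (boundary \<Delta> c) \<tau> = (- boundary L (link_part v c)) \<tau>"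
  proof (cases "v \<in> \<tau> \<or> infinite \<tau>")
    case True
    \<comment> \<open>Chains vanish on infinite sets; these are set aside since the sign rule below counts
      elements and so needs a finite \<open>\<tau>\<close>.\<close>
    moreover have "c \<sigma> = 0" if "infinite \<sigma>" for \<sigma>
      using c that finite_face unfolding chains_def by auto
    ultimately show ?thesis
      unfolding fun_Compl_def boundary_L[OF link_part_chain[OF c]]
      by (auto simp: link_part_def boundary_\<Delta>[OF c] intro!: sum.neutral)
  next
    case False
    then have v: "v \<notin> \<tau>" and fin: "finite \<tau>" by auto
    have "boundary L (link_part v c) \<tau> = (\<Sum>w \<in> vertices \<Delta> - \<tau> - {v}.
        incidence_sign w \<tau> * (incidence_sign v (insert w \<tau>) * c (insert v (insert w \<tau>))))"
      unfolding boundary_L[OF link_part_chain[OF c]]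
      by (rule sum.mono_neutral_cong_right)
        (use v finite_vertices[OF complex] in \<open>auto simp: link_part_def\<close>)
    also have "\<dots> = (\<Sum>w \<in> vertices \<Delta> - \<tau> - {v}.
        - (incidence_sign v \<tau> * (incidence_sign w (insert v \<tau>) * c (insert w (insert v \<tau>)))))"
    proof (rule sum.cong[OF refl])
      fix w assume "w \<in> vertices \<Delta> - \<tau> - {v}"
      then have "incidence_sign v \<tau> * incidence_sign w (insert v \<tau>)
          = - (incidence_sign w \<tau> * incidence_sign v (insert w \<tau>) :: 'b)"
        using incidence_sign_swap[OF fin v, of w] by auto
      then show "incidence_sign w \<tau> * (incidence_sign v (insert w \<tau>) * c (insert v (insert w \<tau>)))
          = - (incidence_sign v \<tau> * (incidence_sign w (insert v \<tau>) * c (insert w (insert v \<tau>))))"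
        by (simp add: insert_commute[of v w] flip: mult.assoc)
    qed
    also have "\<dots> = - (incidence_sign v \<tau> * boundary \<Delta> c (insert v \<tau>))"
    proof -
      have "vertices \<Delta> - insert v \<tau> = vertices \<Delta> - \<tau> - {v}" by auto
      then show ?thesis unfolding boundary_\<Delta>[OF c] by (simp add: sum_distrib_left sum_negf)
    qed
    finally show ?thesis using v by (simp add: link_part_def)
  qed
qed

lemma boundary_eqI:
  assumes "x \<in> chains \<Delta> i" "link_part v y = - boundary L (link_part v x)"
    "deletion_part v y = boundary D (deletion_part v x) + link_part v x"
  shows "boundary \<Delta> x = y"
  by (rule eq_if_parts_eq[of v])
    (simp_all add: assms(2,3) link_part_boundary[OF assms(1)] deletion_part_boundary[OF assms(1)])

lemma link_part_cycle:
  assumes "c \<in> cycles \<Delta> i"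
  shows "link_part v c \<in> cycles L (i - 1)"
proof -
  have "- boundary L (link_part v c) = link_part v 0"
    using assms link_part_boundary[of c i] unfolding cycles_def by auto
  also have "\<dots> = 0" by (auto simp: link_part_def)
  finally show ?thesis using assms link_part_chain unfolding cycles_def by auto
qed

lemma link_part_of_boundary:
  assumes "b \<in> boundaries \<Delta> i"
  shows "link_part v b \<in> boundaries L (i - 1)"
proof -
  obtain x where x: "x \<in> chains \<Delta> (i + 1)" "b = boundary \<Delta> x"
    using assms unfolding boundaries_def by auto
  have "link_part v b = boundary L (- link_part v x)"
    using link_part_boundary[OF x(1)] x(2) by (simp add: boundary_uminus)
  then show ?thesis
    using chains_uminus[OF link_part_chain[OF x(1)]] unfolding boundaries_def by auto
qed

lemma link_cycle_imp_deletion_cycle: "z \<in> cycles L i \<Longrightarrow> z \<in> cycles D i"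
  unfolding cycles_def using boundary_link_eq_deletion link_chain_imp_deletion_chain by auto

lemma deletion_cycle_imp_cycle: "z \<in> cycles D i \<Longrightarrow> z \<in> cycles \<Delta> i"
  unfolding cycles_def using boundary_deletion_eq deletion_chain_imp_chain by auto

lemma link_boundary_imp_deletion_boundary: "z \<in> boundaries L i \<Longrightarrow> z \<in> boundaries D i"
  unfolding boundaries_def using boundary_link_eq_deletion link_chain_imp_deletion_chain by blast

lemma deletion_boundary_imp_boundary: "z \<in> boundaries D i \<Longrightarrow> z \<in> boundaries \<Delta> i"
  unfolding boundaries_def using boundary_deletion_eq deletion_chain_imp_chain by blast

text \<open>
  If the link part of a cycle is the boundary of \<open>l\<close>, then adding the boundary of the cone over \<open>l\<close>
  moves the cycle into the deletion within its class.
\<close>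

lemma exact_at_complex:
  assumes "c \<in> cycles \<Delta> i" "link_part v c \<in> boundaries L (i - 1)"
  shows "\<exists>y \<in> cycles D i. c - y \<in> boundaries \<Delta> i"
proof -
  have c: "c \<in> chains \<Delta> i" "boundary \<Delta> c = 0" using assms unfolding cycles_def by auto
  obtain l where l: "l \<in> chains L i" "link_part v c = boundary L l"
    using assms(2) unfolding boundaries_def by auto
  let ?y = "deletion_part v c + l"
  have y: "?y \<in> chains D i"
    by (intro chains_add deletion_part_chain[OF c(1)] link_chain_imp_deletion_chain[OF l(1)])
  have "boundary D ?y = deletion_part v (boundary \<Delta> c)"
    using deletion_part_boundary[OF c(1)] l(2) boundary_link_eq_deletion[OF l(1)]
    by (simp add: boundary_add)
  also have "\<dots> = 0" unfolding c(2) by (auto simp: deletion_part_def)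
  finally have cyc: "?y \<in> cycles D i" using y unfolding cycles_def by simp
  have l': "- l \<in> chains L i" by (rule chains_uminus[OF l(1)])
  have J: "join_parts v (- l) 0 \<in> chains \<Delta> (i + 1)"
    using join_parts_chain[of "- l" "i + 1" 0] l' by (simp add: chains_zero)
  have "boundary \<Delta> (join_parts v (- l) 0) = c - ?y"
    by (rule boundary_eqI[OF J])
      (simp_all only: parts_join_parts[OF l' chains_zero] link_part_diff deletion_part_diff
        deletion_chain_parts[OF y] l(2) boundary_uminus boundary_zero, simp_all)
  then have "c - ?y \<in> boundaries \<Delta> i" using J unfolding boundaries_def by force
  with cyc show ?thesis by blast
qed

text \<open>
  If \<open>z\<close> is the boundary of \<open>x\<close> in \<open>\<Delta>\<close>, then the deletion part of \<open>x\<close> has as boundary the difference of \<open>z\<close> and the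
  link part of \<open>x\<close>, and that link part is closed because \<open>z\<close> avoids \<open>v\<close>.
\<close>

lemma exact_at_deletion:
  assumes "z \<in> cycles D i" "z \<in> boundaries \<Delta> i"
  shows "\<exists>l \<in> cycles L i. z - l \<in> boundaries D i"
proof -
  have z: "z \<in> chains D i" using assms unfolding cycles_def by auto
  obtain x where x: "x \<in> chains \<Delta> (i + 1)" "z = boundary \<Delta> x"
    using assms(2) unfolding boundaries_def by auto
  have "boundary L (link_part v x) = 0"
    using link_part_boundary[OF x(1)] deletion_chain_parts(1)[OF z] x(2) by simp
  then have "link_part v x \<in> cycles L i"
    using link_part_chain[OF x(1)] unfolding cycles_def by simp
  moreover have "z - link_part v x = boundary D (deletion_part v x)"
    using deletion_part_boundary[OF x(1)] deletion_chain_parts(2)[OF z] x(2)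
    by (metis add_diff_cancel_right')
  ultimately show ?thesis
    using deletion_part_chain[OF x(1)] unfolding boundaries_def by blast
qed

text \<open>
  A cycle of the link that bounds in the deletion can be capped off on both sides: the cone over
  it and a chain of the deletion with that boundary fit together to a cycle of \<open>\<Delta>\<close>.
\<close>

lemma exact_at_link:
  assumes "z \<in> cycles L i" "z \<in> boundaries D i"
  shows "\<exists>c \<in> cycles \<Delta> (i + 1). link_part v c = z"
proof -
  have z: "z \<in> chains L i" "boundary L z = 0" using assms unfolding cycles_def by auto
  obtain e where e: "e \<in> chains D (i + 1)" "z = boundary D e"
    using assms(2) unfolding boundaries_def by auto
  have e': "- e \<in> chains D (i + 1)" by (rule chains_uminus[OF e(1)])
  have J: "join_parts v z (- e) \<in> chains \<Delta> (i + 1)"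
    using join_parts_chain[of z "i + 1"] z(1) e' by simp
  have "boundary \<Delta> (join_parts v z (- e)) = 0"
    by (rule boundary_eqI[OF J])
      (simp_all add: parts_join_parts[OF z(1) e'] z(2) boundary_uminus flip: e(2),
        auto simp: link_part_def deletion_part_def)
  then show ?thesis using J parts_join_parts(1)[OF z(1) e'] unfolding cycles_def by auto
qed

section \<open>Consequences of exactness for vanishing of homology\<close>

lemma homology_zero_complex:
  assumes D0: "homology_zero TYPE('k::field) D i" and L0: "homology_zero TYPE('k) L (i - 1)"
  shows "homology_zero TYPE('k) \<Delta> i"
  unfolding homology_zero_iff
proof
  fix c :: "'a set \<Rightarrow> 'k" assume c: "c \<in> cycles \<Delta> i"
  then have "link_part v c \<in> boundaries L (i - 1)"
    using L0 link_part_cycle unfolding homology_zero_iff by blast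
  then obtain y where "y \<in> cycles D i" "c - y \<in> boundaries \<Delta> i"
    using exact_at_complex[OF c] by blast
  then show "c \<in> boundaries \<Delta> i"
    using D0 deletion_boundary_imp_boundary boundaries_of_diff unfolding homology_zero_iff by blast
qed

lemma homology_zero_deletion:
  assumes "homology_zero TYPE('k::field) \<Delta> i" "homology_zero TYPE('k) L i"
  shows "homology_zero TYPE('k) D i"
  using assms exact_at_deletion deletion_cycle_imp_cycle link_boundary_imp_deletion_boundary
    boundaries_of_diff
  unfolding homology_zero_iff by blast

lemma homology_zero_link:
  assumes "homology_zero TYPE('k::field) D i" "homology_zero TYPE('k) \<Delta> (i + 1)"
  shows "homology_zero TYPE('k) L i"
  unfolding homology_zero_iff
proof
  fix z :: "'a set \<Rightarrow> 'k" assume z: "z \<in> cycles L i"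
  then have "z \<in> boundaries D i"
    using assms(1) link_cycle_imp_deletion_cycle unfolding homology_zero_iff by blast
  then obtain c where "c \<in> cycles \<Delta> (i + 1)" "link_part v c = z"
    using exact_at_link[OF z] by blast
  then show "z \<in> boundaries L i"
    using assms(2) link_part_of_boundary[of c "i + 1"] unfolding homology_zero_iff by auto
qed

end

section \<open>Induced subcomplexes and links of faces\<close>

lemma induced_subcomplex_eq_self:
  assumes "simplicial_complex \<Delta>" "vertices \<Delta> \<subseteq> A"
  shows "induced_subcomplex \<Delta> A = \<Delta>"
proof -
  have "\<sigma> \<subseteq> A" if "\<sigma> \<in> \<Delta>" for \<sigma>
  proof
    fix u assume "u \<in> \<sigma>"
    then have "{u} \<in> \<Delta>" using simplicial_complex_subface[OF assms(1) that, of "{u}"] by auto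
    then show "u \<in> A" using assms(2) unfolding vertices_def by blast
  qed
  then show ?thesis unfolding induced_subcomplex_def by auto
qed

lemma induced_subcomplex_deletion:
  "v \<notin> A \<Longrightarrow> induced_subcomplex (deletion \<Delta> v) A = induced_subcomplex \<Delta> A"
  unfolding induced_subcomplex_def deletion_def by auto

lemma deletion_induced_subcomplex_insert:
  "v \<notin> A \<Longrightarrow> deletion (induced_subcomplex \<Delta> (insert v A)) v = induced_subcomplex \<Delta> A"
  unfolding induced_subcomplex_def deletion_def by auto

lemma vertex_link_induced_subcomplex_insert:
  "v \<notin> A \<Longrightarrow> vertex_link (induced_subcomplex \<Delta> (insert v A)) v = induced_subcomplex (vertex_link \<Delta> v) A"
  unfolding induced_subcomplex_def vertex_link_def deletion_def by auto

lemma simplicial_complex_induced_subcomplex: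
  "simplicial_complex \<Delta> \<Longrightarrow> simplicial_complex (induced_subcomplex \<Delta> A)"
  unfolding simplicial_complex_def induced_subcomplex_def by auto

lemma face_link_empty: "face_link \<Delta> {} = \<Delta>"
  unfolding face_link_def by auto

lemma simplicial_complex_face_link:
  assumes "simplicial_complex \<Delta>"
  shows "simplicial_complex (face_link \<Delta> \<sigma>)"
  unfolding simplicial_complex_def
proof (intro conjI ballI allI impI)
  have sub: "face_link \<Delta> \<sigma> \<subseteq> \<Delta>" unfolding face_link_def by auto
  then show "finite (face_link \<Delta> \<sigma>)"
    using assms finite_subset unfolding simplicial_complex_def by auto
  show "finite \<tau>" if "\<tau> \<in> face_link \<Delta> \<sigma>" for \<tau>
    using that sub assms unfolding simplicial_complex_def by auto
  show "\<rho> \<in> face_link \<Delta> \<sigma>" if "\<tau> \<in> face_link \<Delta> \<sigma>" "\<rho> \<subseteq> \<tau>" for \<tau> \<rho>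
  proof -
    have "\<tau> \<in> \<Delta>" "\<tau> \<union> \<sigma> \<in> \<Delta>" "\<rho> \<inter> \<sigma> = {}" "\<rho> \<union> \<sigma> \<subseteq> \<tau> \<union> \<sigma>"
      using that unfolding face_link_def by auto
    then show ?thesis
      using simplicial_complex_subface[OF assms] that(2) unfolding face_link_def by auto
  qed
qed

context
  fixes \<Delta> :: "'a::linorder set set" and \<sigma> :: "'a set" and v :: 'a
  assumes cx: "simplicial_complex \<Delta>" and face: "insert v \<sigma> \<in> \<Delta>" and v: "v \<notin> \<sigma>"
begin

lemma face_in_vertex_link: "\<sigma> \<in> vertex_link \<Delta> v"
  using simplicial_complex_subface[OF cx face, of \<sigma>] face v
  unfolding vertex_link_def deletion_def by auto

lemma vertex_of_face: "v \<in> vertices \<Delta>"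
  using simplicial_complex_subface[OF cx face, of "{v}"] unfolding vertices_def by auto

lemma vertex_of_face_link: "v \<in> vertices (face_link \<Delta> \<sigma>)"
  using vertex_of_face face v unfolding vertices_def face_link_def by auto

lemma union_face_subfaces:
  assumes "\<tau> \<union> insert v \<sigma> \<in> \<Delta>"
  shows "\<tau> \<union> {v} \<in> \<Delta>" "\<tau> \<union> \<sigma> \<in> \<Delta>"
  by (auto intro: simplicial_complex_subface[OF cx assms])

lemma face_link_vertex_link: "face_link (vertex_link \<Delta> v) \<sigma> = face_link \<Delta> (insert v \<sigma>)"
  using v union_face_subfaces unfolding face_link_def vertex_link_def deletion_def by auto

lemma vertex_link_face_link: "vertex_link (face_link \<Delta> \<sigma>) v = face_link \<Delta> (insert v \<sigma>)"
  using v union_face_subfaces unfolding face_link_def vertex_link_def deletion_def by auto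

lemma deletion_face_link: "deletion (face_link \<Delta> \<sigma>) v = face_link (deletion \<Delta> v) \<sigma>"
  using v unfolding face_link_def deletion_def by auto

end

section \<open>Degree bounds in spherical complexes\<close>

lemma spherical_simplicial_complex: "spherical K \<Delta> \<Longrightarrow> simplicial_complex \<Delta>"
  by (auto elim: spherical.cases)

lemma spherical_degree_unique:
  "\<lbrakk>spherical TYPE('k::field) \<Delta>; \<not> homology_zero TYPE('k) \<Delta> i; \<not> homology_zero TYPE('k) \<Delta> j\<rbrakk>
    \<Longrightarrow> i = j"
  by (elim spherical.cases) (metis Uniq_D)

text \<open>
  The outer induction descends to the link and the deletion of a vertex \<open>v\<close> outside \<open>A\<close>, the inner one
  enlarges \<open>A\<close> by \<open>v\<close>.  The missing vertices are counted as \<open>vertices \<Delta> - A\<close> for an arbitrary set \<open>A\<close>,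
  since an element of \<open>A\<close> can be a vertex of \<open>\<Delta>\<close> without being one of the link of \<open>v\<close>.
\<close>

lemma induced_subcomplex_degree_bounds:
  assumes "spherical TYPE('k::field) \<Delta>"
    and "\<not> homology_zero TYPE('k) \<Delta> d"
    and "\<not> homology_zero TYPE('k) (induced_subcomplex \<Delta> A) e"
  shows "d - int (card (vertices \<Delta> - A)) \<le> e \<and> e \<le> d"
  using assms
proof (induction arbitrary: d e A rule: spherical.induct)
  case (sphericalI \<Delta>)
  note cx = sphericalI(1) and fin = finite_vertices[OF sphericalI(1)]
  have S: "spherical TYPE('k) \<Delta>"
    by (rule spherical.sphericalI[OF sphericalI(1-5)])
  show ?case
    using sphericalI.prems(2)
  proof (induction "card (vertices \<Delta> - A)" arbitrary: A e rule: less_induct)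
    case less
    show ?case
    proof (cases "vertices \<Delta> \<subseteq> A")
      case True
      then have "e = d"
        using induced_subcomplex_eq_self[OF cx True] less.prems sphericalI.prems(1)
          spherical_degree_unique[OF S] by metis
      then show ?thesis by simp
    next
      case False
      then obtain v where v: "v \<in> vertices \<Delta>" "v \<notin> A" by blast
      interpret complex_with_vertex \<Delta> v using cx v(1) by unfold_locales
      let ?\<Sigma> = "induced_subcomplex \<Delta> (insert v A)"
      have diff: "vertices D - A = vertices \<Delta> - insert v A"
        by (auto simp: vertices_deletion)
      have card: "card (vertices \<Delta> - A) = Suc (card (vertices \<Delta> - insert v A))"
        using v fin by (metis DiffI Diff_insert card.remove finite_Diff)
      show ?thesis
      proof (cases "homology_zero TYPE('k) D d")
        case False
        then show ?thesis
          using sphericalI(7)[OF v(1), of d A e] less.prems induced_subcomplex_deletion[OF v(2)]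
            diff card by auto
      next
        case True
        have v\<Sigma>: "v \<in> vertices ?\<Sigma>" using v unfolding vertices_def induced_subcomplex_def by auto
        have De: "\<not> homology_zero TYPE('k) (deletion ?\<Sigma> v) e"
          using less.prems deletion_induced_subcomplex_insert[OF v(2)] by metis
        show ?thesis
        proof (cases "homology_zero TYPE('k) ?\<Sigma> e")
          case False
          then show ?thesis using less.hyps[of "insert v A" e] card by auto
        next
          case \<Sigma>e: True
          \<comment> \<open>Both deletions of \<open>v\<close>, in \<open>\<Delta>\<close> and in \<open>?\<Sigma>\<close>, change the homology in the relevant degree:
            the comparison takes place in the link of \<open>v\<close>.\<close>
          interpret \<Sigma>: complex_with_vertex ?\<Sigma> v
            using simplicial_complex_induced_subcomplex[OF cx] v\<Sigma> by unfold_locales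
          have "\<not> homology_zero TYPE('k) (vertex_link ?\<Sigma> v) e"
            using \<Sigma>.homology_zero_deletion[OF \<Sigma>e] De by blast
          then have "\<not> homology_zero TYPE('k) (induced_subcomplex L A) e"
            using vertex_link_induced_subcomplex_insert[OF v(2)] by metis
          moreover have "\<not> homology_zero TYPE('k) L (d - 1)"
            using homology_zero_complex[OF True] sphericalI.prems(1) by blast
          ultimately have "d - 1 - int (card (vertices L - A)) \<le> e \<and> e \<le> d - 1"
            using sphericalI(6)[OF v(1)] by blast
          moreover have "card (vertices L - A) \<le> card (vertices \<Delta> - insert v A)"
            using vertices_vertex_link[of \<Delta> v] fin by (intro card_mono) auto
          ultimately show ?thesis using card by auto
        qed
      qed
    qed
  qed
qed

text \<open>
  The dual argument, for a face \<open>insert v \<tau>\<close>: the question is reduced to \<open>L\<close> if \<open>L\<close> has homology in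
  degree \<open>d - 1\<close>, and to the smaller face \<open>\<tau>\<close> if its link has homology in degree \<open>e + 1\<close>; otherwise
  the comparison takes place in the deletion of \<open>v\<close>.
\<close>

lemma face_link_degree_bounds:
  assumes "spherical TYPE('k::field) \<Delta>"
    and "\<not> homology_zero TYPE('k) \<Delta> d" and "\<sigma> \<in> \<Delta>"
    and "\<not> homology_zero TYPE('k) (face_link \<Delta> \<sigma>) e"
  shows "d - int (card \<sigma>) \<le> e \<and> e \<le> d"
  using assms
proof (induction arbitrary: d e \<sigma> rule: spherical.induct)
  case (sphericalI \<Delta>)
  note cx = sphericalI(1)
  have S: "spherical TYPE('k) \<Delta>"
    by (rule spherical.sphericalI[OF sphericalI(1-5)])
  have "finite \<sigma>" using cx sphericalI.prems(2) unfolding simplicial_complex_def by blast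
  then show ?case
    using sphericalI.prems(2,3)
  proof (induction \<sigma> arbitrary: e rule: finite_induct)
    case empty
    then have "e = d"
      using face_link_empty sphericalI.prems(1) spherical_degree_unique[OF S] by metis
    then show ?case by simp
  next
    case (insert v \<tau>)
    note face = insert.prems(1)
    note v = vertex_of_face[OF cx face insert.hyps(2)]
    interpret complex_with_vertex \<Delta> v using cx v by unfold_locales
    let ?\<Lambda> = "face_link \<Delta> \<tau>"
    have \<tau>: "\<tau> \<in> L" by (rule face_in_vertex_link[OF cx face insert.hyps(2)])
    then have \<tau>D: "\<tau> \<in> D" "\<tau> \<in> \<Delta>" unfolding vertex_link_def deletion_def by auto
    show ?case
    proof (cases "homology_zero TYPE('k) L (d - 1)")
      case False
      have "\<not> homology_zero TYPE('k) (face_link L \<tau>) e"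
        using insert.prems(2) face_link_vertex_link[OF cx face insert.hyps(2)] by metis
      then have "d - 1 - int (card \<tau>) \<le> e \<and> e \<le> d - 1"
        by (rule sphericalI(6)[OF v False \<tau>])
      then show ?thesis using insert.hyps by auto
    next
      case True
      have v\<Lambda>: "v \<in> vertices ?\<Lambda>" by (rule vertex_of_face_link[OF cx face insert.hyps(2)])
      have Le: "\<not> homology_zero TYPE('k) (vertex_link ?\<Lambda> v) e"
        using insert.prems(2) vertex_link_face_link[OF cx face insert.hyps(2)] by metis
      show ?thesis
      proof (cases "homology_zero TYPE('k) ?\<Lambda> (e + 1)")
        \<comment> \<open>Degree \<open>e + 1\<close> because a class of the link of \<open>v\<close> in \<open>?\<Lambda>\<close> lies one degree lower.\<close>
        case False
        then show ?thesis
          using insert.IH[OF \<tau>D(2) False] insert.hyps by auto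
      next
        case \<Lambda>e: True
        interpret \<Lambda>: complex_with_vertex ?\<Lambda> v
          using simplicial_complex_face_link[OF cx] v\<Lambda> by unfold_locales
        have "\<not> homology_zero TYPE('k) (deletion ?\<Lambda> v) e"
          using \<Lambda>.homology_zero_link[OF _ \<Lambda>e] Le by blast
        then have "\<not> homology_zero TYPE('k) (face_link D \<tau>) e"
          using deletion_face_link[OF cx face insert.hyps(2)] by metis
        moreover have "\<not> homology_zero TYPE('k) D d"
          using homology_zero_complex[OF _ True] sphericalI.prems(1) by blast
        ultimately have "d - int (card \<tau>) \<le> e \<and> e \<le> d"
          using sphericalI(7)[OF v] \<tau>D(1) by blast
        then show ?thesis using insert.hyps by auto
      qed
    qed
  qed
qed

theorem theorem1p2:
  fixes \<Delta> :: "'a::linorder set set" and n :: nat and d :: int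
  assumes "spherical TYPE('k::field) \<Delta>"
    and "card (vertices \<Delta>) = n"
    and "homology_iso_field TYPE('k) \<Delta> d"
  shows "(\<forall>A (m::nat) (d'::int).
            A \<subseteq> vertices \<Delta> \<and> card A = m \<and>
            homology_iso_field TYPE('k) (induced_subcomplex \<Delta> A) d' \<longrightarrow>
            d - (int n - int m) \<le> d' \<and> d' \<le> d)
       \<and> (\<forall>\<sigma> \<in> \<Delta>. \<forall>(k::nat) (d''::int).
            card \<sigma> = k \<and>
            homology_iso_field TYPE('k) (face_link \<Delta> \<sigma>) d'' \<longrightarrow>
            d - int k \<le> d'' \<and> d'' \<le> d)
       \<and> int (leray_number TYPE('k) \<Delta>) = d + 1"
proof (intro conjI)
  note cx = spherical_simplicial_complex[OF assms(1)]
  note nz = homology_iso_field_not_zero[OF assms(3)]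
  note bounds = induced_subcomplex_degree_bounds[OF assms(1) nz]
  show "\<forall>A (m::nat) (d'::int).
            A \<subseteq> vertices \<Delta> \<and> card A = m \<and>
            homology_iso_field TYPE('k) (induced_subcomplex \<Delta> A) d' \<longrightarrow>
            d - (int n - int m) \<le> d' \<and> d' \<le> d"
  proof (intro allI impI, elim conjE)
    fix A m d'
    assume A: "A \<subseteq> vertices \<Delta>" "card A = m"
      and iso: "homology_iso_field TYPE('k) (induced_subcomplex \<Delta> A) d'"
    have "int (card (vertices \<Delta> - A)) = int n - int m"
      using A assms(2) finite_vertices[OF cx] card_mono[OF _ A(1)]
      by (simp add: card_Diff_subset finite_subset of_nat_diff)
    then show "d - (int n - int m) \<le> d' \<and> d' \<le> d"
      using bounds[OF homology_iso_field_not_zero[OF iso]] by simp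
  qed
  show "\<forall>\<sigma> \<in> \<Delta>. \<forall>(k::nat) (d''::int).
            card \<sigma> = k \<and>
            homology_iso_field TYPE('k) (face_link \<Delta> \<sigma>) d'' \<longrightarrow>
            d - int k \<le> d'' \<and> d'' \<le> d"
    using face_link_degree_bounds[OF assms(1) nz] homology_iso_field_not_zero by blast
  \<comment> \<open>The Leray number is natural, so its value \<open>d + 1\<close> must be nonnegative.\<close>
  have d: "d \<ge> -1" using homology_zero_below nz by (metis not_le)
  have "leray_number TYPE('k) \<Delta> = nat (d + 1)"
    unfolding leray_number_def
  proof (rule Least_equality)
    show "\<forall>A \<subseteq> vertices \<Delta>. \<forall>i \<ge> int (nat (d + 1)).
        homology_zero TYPE('k) (induced_subcomplex \<Delta> A) i"
      using bounds d by force
  next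
    fix y
    assume y: "\<forall>A \<subseteq> vertices \<Delta>. \<forall>i \<ge> int y. homology_zero TYPE('k) (induced_subcomplex \<Delta> A) i"
    then have "\<not> d \<ge> int y"
      using nz induced_subcomplex_eq_self[OF cx order_refl] by (metis order_refl)
    then show "nat (d + 1) \<le> y" by linarith
  qed
  then show "int (leray_number TYPE('k) \<Delta>) = d + 1" using d by simp
qed

end
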